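(* Let $\mathcal{B}$ be a real Banach space. If there exists a functional $F:\mathcal{B}\to\mathbb{R}$ that is both $\mu$-strongly convex and $\gamma$-smooth for some $\mu>0$ and $\gamma<\infty$, then $\mathcal{B}$ is isomorphic (i.e. linearly homeomorphic) to a Hilbert space.
   Context: $\mathcal{B}^*$ is the dual Banach space and $\langle f,g\rangle_{\mathcal{B}}=g(f)$. For $F:\mathcal{B}\to\mathbb{R}$, the subgradient set at $f_0$ is $\partial_{f_0}F=\{g\in\mathcal{B}^*:\ F(f)\ge F(f_0)+\langle f-f_0,g\rangle_{\mathcal{B}}\ \forall f\in\mathcal{B}\}$. $F$ is $\mu$-strongly convex if for all $f_0\in\mathcal{B}$ there is $g\in\partial_{f_0}F$ such that for all $f\in\mathcal{B}$: $F(f)-F(f_0)\ge\langle f-f_0,g\rangle_{\mathcal{B}}+\frac{\mu}{2}\|f-f_0\|_{\mathcal{B}}^2$. $F$ is $\gamma$-smooth if for all $f_0\in\mathcal{B}$ there is $g\in\partial_{f_0}F$ such that for all $f\in\mathcal{B}$: $F(f)-F(f_0)\le\langle f-f_0,g\rangle_{\mathcal{B}}+\frac{\gamma}{2}\|f-f_0\|_{\mathcal{B}}^2$. *)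

theory Defs
  imports "HOL-Analysis.Analysis" "HOL-Algebra.Module"
begin

definition subgradients :: "('a::real_normed_vector \<Rightarrow> real) \<Rightarrow> 'a \<Rightarrow> ('a \<Rightarrow>\<^sub>L real) set" where
  "subgradients F f0 = {g. \<forall>f. F f \<ge> F f0 + blinfun_apply g (f - f0)}"

definition strongly_convex :: "real \<Rightarrow> ('a::real_normed_vector \<Rightarrow> real) \<Rightarrow> bool" where
  "strongly_convex \<mu> F \<longleftrightarrow>
     (\<forall>f0. \<exists>g\<in>subgradients F f0. \<forall>f.
        F f - F f0 \<ge> blinfun_apply g (f - f0) + \<mu> / 2 * (norm (f - f0))\<^sup>2)"

definition smooth :: "real \<Rightarrow> ('a::real_normed_vector \<Rightarrow> real) \<Rightarrow> bool" where
  "smooth \<gamma> F \<longleftrightarrow>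
     (\<forall>f0. \<exists>g\<in>subgradients F f0. \<forall>f.
        F f - F f0 \<le> blinfun_apply g (f - f0) + \<gamma> / 2 * (norm (f - f0))\<^sup>2)"

text \<open>A Hilbert space is needed as an object that can be existentially quantified, which the
  type classes \<open>real_inner\<close> and \<open>complete_space\<close> do not allow. It is therefore a carrier-based
  vector space over the reals, with all its operations explicit, together with an inner product.
  The record fields \<open>mult\<close> and \<open>one\<close> of the vector space play no role.\<close>

definition real_scalars :: "real ring" where
  "real_scalars = \<lparr>carrier = UNIV, mult = (*), one = 1, zero = 0, add = (+)\<rparr>"

text \<open>The value outside the carrier is irrelevant to topology and completeness; it is fixed because
  \<open>Metric_space\<close> demands a symmetric nonnegative function on the whole type.\<close>

definition inner_dist :: "(real, 'b) module \<Rightarrow> ('b \<Rightarrow> 'b \<Rightarrow> real) \<Rightarrow> 'b \<Rightarrow> 'b \<Rightarrow> real" where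
  "inner_dist H ip x y =
     (if x \<in> carrier H \<and> y \<in> carrier H
      then sqrt (ip (x \<ominus>\<^bsub>H\<^esub> y) (x \<ominus>\<^bsub>H\<^esub> y)) else 0)"

locale real_hilbert_space = vector_space: Module.module real_scalars H
  for H :: "(real, 'b) module" +
  fixes ip :: "'b \<Rightarrow> 'b \<Rightarrow> real"
  assumes ip_commute:
      "\<lbrakk>x \<in> carrier H; y \<in> carrier H\<rbrakk> \<Longrightarrow> ip x y = ip y x"
    and ip_add_left:
      "\<lbrakk>x \<in> carrier H; y \<in> carrier H; z \<in> carrier H\<rbrakk> \<Longrightarrow> ip (x \<oplus>\<^bsub>H\<^esub> y) z = ip x z + ip y z"
    and ip_smult_left:
      "\<lbrakk>x \<in> carrier H; y \<in> carrier H\<rbrakk> \<Longrightarrow> ip (c \<odot>\<^bsub>H\<^esub> x) y = c * ip x y"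
    and ip_pos:
      "\<lbrakk>x \<in> carrier H; x \<noteq> \<zero>\<^bsub>H\<^esub>\<rbrakk> \<Longrightarrow> ip x x > 0"
    and complete: "Metric_space.mcomplete (carrier H) (inner_dist H ip)"

definition linear_homeomorphism ::
    "('a::real_normed_vector \<Rightarrow> 'b) \<Rightarrow> (real, 'b) module \<Rightarrow> ('b \<Rightarrow> 'b \<Rightarrow> real) \<Rightarrow> bool" where
  "linear_homeomorphism T H ip \<longleftrightarrow>
     (\<forall>x y. T (x + y) = T x \<oplus>\<^bsub>H\<^esub> T y) \<and>
     (\<forall>c x. T (c *\<^sub>R x) = c \<odot>\<^bsub>H\<^esub> T x) \<and>
     homeomorphic_map euclidean (Metric_space.mtopology (carrier H) (inner_dist H ip)) T"

text \<open>Taking the elements of the Hilbert space from the type of the Banach space is no restriction: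
  the structure of a Hilbert space on any other type can be transported along the bijection \<open>T\<close>.
  Neither its operations nor its carrier are tied to those of the Banach space.\<close>

definition isomorphic_to_hilbert_space :: "'a::banach itself \<Rightarrow> bool" where
  "isomorphic_to_hilbert_space _ \<longleftrightarrow>
     (\<exists>(H :: (real, 'a) module) ip (T :: 'a \<Rightarrow> 'a).
        real_hilbert_space H ip \<and> linear_homeomorphism T H ip)"

end

theory Submission
  imports Defs
begin

text \<open>The second differences \<open>F (f + x) + F (f - x) - 2 * F f\<close> lie between \<open>\<mu> * (norm x)\<^sup>2\<close> and
  \<open>\<gamma> * (norm x)\<^sup>2\<close>. If they did not depend on \<open>f\<close>, they would satisfy the parallelogram law in
  \<open>x\<close>. Replacing \<open>F\<close> by its averages along \<open>f, f + y, f + 2y, \<dots>\<close> keeps the bounds and makes the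
  dependence on \<open>f\<close> in the direction \<open>y\<close> arbitrarily small, for finitely many directions at once.
  Compactness of the set of functions between the two bounds (Tychonoff) yields a function that
  satisfies the parallelogram law exactly, and by Jordan and von Neumann it comes from an inner
  product, whose norm is equivalent to the original one.\<close>

section \<open>Second differences\<close>

definition second_diff :: "('a::real_vector \<Rightarrow> real) \<Rightarrow> 'a \<Rightarrow> 'a \<Rightarrow> real" where
  "second_diff F x f = F (f + x) + F (f - x) - 2 * F f"

text \<open>Both sides expand to the sum of \<open>F\<close> over the four points \<open>f\<close>
  \<plusminus> \<open>x\<close> \<plusminus> \<open>y\<close>, minus \<open>4 * F f\<close>. The
  shifted base points on the right are the only defect from the parallelogram law in
  \<open>x\<close> and \<open>y\<close>.\<close>

lemma second_diff_parallelogram: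
  "second_diff F (x + y) f + second_diff F (x - y) f =
     second_diff F x (f + y) + second_diff F x (f - y) + 2 * second_diff F y f"
  by (simp add: second_diff_def algebra_simps)

text \<open>Adding the inequalities for one \<open>g\<close> at \<open>f + x\<close> and
  \<open>f - x\<close> cancels the linear terms; the two halves of \<mu> add up. Smoothness gives
  the upper bound in the same way.\<close>

lemma strongly_convex_second_diff:
  assumes "strongly_convex \<mu> F"
  shows "\<mu> * (norm x)\<^sup>2 \<le> second_diff F x f"
proof -
  obtain g where g: "\<And>h. F h - F f \<ge> blinfun_apply g (h - f) + \<mu> / 2 * (norm (h - f))\<^sup>2"
    using assms unfolding strongly_convex_def by blast
  show ?thesis
    using g[of "f + x"] g[of "f - x"]
    by (simp add: second_diff_def blinfun.minus_right)
qed

lemma smooth_second_diff: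
  assumes "smooth \<gamma> F"
  shows "second_diff F x f \<le> \<gamma> * (norm x)\<^sup>2"
proof -
  obtain g where g: "\<And>h. F h - F f \<le> blinfun_apply g (h - f) + \<gamma> / 2 * (norm (h - f))\<^sup>2"
    using assms unfolding smooth_def by blast
  show ?thesis
    using g[of "f + x"] g[of "f - x"]
    by (simp add: second_diff_def blinfun.minus_right)
qed

definition shift_average :: "nat \<Rightarrow> 'a \<Rightarrow> ('a::real_vector \<Rightarrow> real) \<Rightarrow> 'a \<Rightarrow> real" where
  "shift_average n y F f = (\<Sum>i<n. F (f + of_nat i *\<^sub>R y)) / of_nat n"

text \<open>A second difference is a linear combination of translates, and averaging commutes with
  translations. Bounds on second differences that are uniform in \<open>f\<close> thus survive
  averaging.\<close>

lemma second_diff_shift_average: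
  "second_diff (shift_average n y F) x = shift_average n y (second_diff F x)"
  by (simp add: fun_eq_iff shift_average_def second_diff_def sum.distrib sum_subtractf
      sum_distrib_left algebra_simps add_divide_distrib diff_divide_distrib)

lemma shift_average_ge:
  assumes "n > 0" "\<And>f. a \<le> F f"
  shows "a \<le> shift_average n y F f"
proof -
  have "of_nat n * a \<le> (\<Sum>i<n. F (f + of_nat i *\<^sub>R y))"
    using sum_bounded_below[of "{..<n}" a "\<lambda>i. F (f + of_nat i *\<^sub>R y)"] assms(2) by simp
  then show ?thesis
    using assms(1) by (simp add: shift_average_def field_simps)
qed

lemma shift_average_minus:
  "shift_average n y (\<lambda>f. - F f) f = - shift_average n y F f"
  by (simp add: shift_average_def sum_negf)

lemma shift_average_le:
  assumes "n > 0" "\<And>f. F f \<le> b"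
  shows "shift_average n y F f \<le> b"
  using shift_average_ge[of n "-b" "\<lambda>f. - F f"] assms by (simp add: shift_average_minus)

text \<open>The sum telescopes. For bounded \<open>F\<close> the increment in direction
  \<open>y\<close> is therefore of order \<open>1 / n\<close>.\<close>

lemma shift_average_diff_self:
  "shift_average n y F (f + y) - shift_average n y F f = (F (f + of_nat n *\<^sub>R y) - F f) / of_nat n"
proof -
  have "(\<Sum>i<n. F (f + y + of_nat i *\<^sub>R y)) - (\<Sum>i<n. F (f + of_nat i *\<^sub>R y)) =
      (\<Sum>i<n. F (f + of_nat (Suc i) *\<^sub>R y) - F (f + of_nat i *\<^sub>R y))"
    by (simp add: sum_subtractf algebra_simps)
  also have "\<dots> = F (f + of_nat n *\<^sub>R y) - F f"
    by (subst sum_lessThan_telescope) simp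
  finally show ?thesis
    by (simp add: shift_average_def flip: diff_divide_distrib)
qed

text \<open>Lets a uniform bound on increments in an earlier direction \<open>z\<close> survive
  averaging along a new direction \<open>y\<close>.\<close>

lemma shift_average_diff_shift:
  "shift_average n y F (f + z) - shift_average n y F f =
     shift_average n y (\<lambda>f. F (f + z) - F f) f"
  by (simp add: shift_average_def sum_subtractf diff_divide_distrib algebra_simps)

section \<open>Almost invariant second differences\<close>

text \<open>A pair \<open>(y, n)\<close> is a direction with a tolerance. Induction on
  \<open>S\<close> averages along one direction at a time, without spoiling the directions already
  treated.\<close>

lemma almost_invariant_second_diff:
  fixes F :: "'a::real_vector \<Rightarrow> real" and S :: "('a \<times> nat) set"
  assumes "finite S"
    and "\<And>x f. a x \<le> second_diff F x f" "\<And>x f. second_diff F x f \<le> b x"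
    and "\<And>x. 0 \<le> a x"
  shows "\<exists>G. (\<forall>x f. a x \<le> second_diff G x f \<and> second_diff G x f \<le> b x) \<and>
    (\<forall>(y, n)\<in>S. \<forall>x f. \<bar>second_diff G x (f + y) - second_diff G x f\<bar> \<le> b x / Suc n)"
  using assms(1)
proof induction
  case empty
  show ?case by (rule exI[of _ F]) (use assms(2,3) in simp)
next
  case (insert p S)
  obtain y n where p: "p = (y, n)" by (cases p)
  obtain G where G: "\<And>x f. a x \<le> second_diff G x f" "\<And>x f. second_diff G x f \<le> b x"
    and inv: "\<And>z m x f. (z, m) \<in> S \<Longrightarrow> \<bar>second_diff G x (f + z) - second_diff G x f\<bar> \<le> b x / Suc m"
    using insert.IH by blast
  define G' where "G' = shift_average (Suc n) y G"
  have "a x \<le> second_diff G' x f \<and> second_diff G' x f \<le> b x" for x f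
    unfolding G'_def second_diff_shift_average
    by (intro conjI shift_average_ge shift_average_le G zero_less_Suc)
  moreover have "\<bar>second_diff G' x (f + y) - second_diff G' x f\<bar> \<le> b x / Suc n" for x f
  proof -
    \<comment> \<open>Both values lie between \<open>a x\<close> and \<open>b x\<close>, and
      \<open>a x\<close> is nonnegative, so they differ by at most \<open>b x\<close>. The
      telescoped average divides this by \<open>Suc n\<close>.\<close>
    have "\<bar>second_diff G x (f + of_nat (Suc n) *\<^sub>R y) - second_diff G x f\<bar> \<le> b x"
      using G(1)[of x "f + of_nat (Suc n) *\<^sub>R y"] G(2)[of x "f + of_nat (Suc n) *\<^sub>R y"]
        G(1)[of x f] G(2)[of x f] assms(4)[of x] by linarith
    then show ?thesis
      unfolding G'_def second_diff_shift_average shift_average_diff_self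
      by (simp add: abs_divide divide_right_mono del: of_nat_Suc)
  qed
  moreover have "\<bar>second_diff G' x (f + z) - second_diff G' x f\<bar> \<le> b x / Suc m"
    if "(z, m) \<in> S" for z m x f
  proof -
    let ?D = "\<lambda>f. second_diff G x (f + z) - second_diff G x f"
    have D: "- (b x / Suc m) \<le> ?D f" "?D f \<le> b x / Suc m" for f
      using inv[OF that, of x f] by linarith+
    have "- (b x / Suc m) \<le> shift_average (Suc n) y ?D f" "shift_average (Suc n) y ?D f \<le> b x / Suc m"
      by (intro shift_average_ge shift_average_le D zero_less_Suc)+
    then show ?thesis
      unfolding G'_def second_diff_shift_average shift_average_diff_shift by linarith
  qed
  ultimately show ?case
    unfolding p by (intro exI[of _ G']) auto
qed

section \<open>Compactness and the exact parallelogram law\<close>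

lemma compact_function_interval:
  fixes a b :: "'a \<Rightarrow> real"
  shows "compact {Q. \<forall>x. a x \<le> Q x \<and> Q x \<le> b x}"
proof -
  \<comment> \<open>Tychonoff: the functions between the bounds form a product of compact intervals,
    in the topology of pointwise convergence.\<close>
  have "compactin (product_topology (\<lambda>_. euclidean) UNIV) (PiE UNIV (\<lambda>x. {a x..b x}))"
    unfolding compactin_PiE by simp
  moreover have "PiE UNIV (\<lambda>x. {a x..b x}) = {Q. \<forall>x. a x \<le> Q x \<and> Q x \<le> b x}"
    by (auto simp: PiE_def Pi_def)
  ultimately show ?thesis
    by (simp add: euclidean_product_topology)
qed

lemma exists_parallelogram:
  fixes F :: "'a::real_vector \<Rightarrow> real"
  assumes "\<And>x f. a x \<le> second_diff F x f" "\<And>x f. second_diff F x f \<le> b x" "\<And>x. 0 \<le> a x"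
  shows "\<exists>Q. (\<forall>x. a x \<le> Q x \<and> Q x \<le> b x) \<and> (\<forall>x y. Q (x + y) + Q (x - y) = 2 * Q x + 2 * Q y)"
proof -
  let ?K = "{Q. \<forall>x. a x \<le> Q x \<and> Q x \<le> b x}"
  \<comment> \<open>The parallelogram law for the fixed \<open>y\<close> up to an error. The set is
    closed since each inequality involves only finitely many values of \<open>Q\<close>; the factor
    2 accounts for two increments of the base point, from 0 to \<open>y\<close> and to
    \<open>- y\<close>.\<close>
  let ?C = "\<lambda>(y, n). {Q. \<forall>x. \<bar>Q (x + y) + Q (x - y) - (2 * Q x + 2 * Q y)\<bar> \<le> 2 * (b x / Suc n)}"
  have "?K \<inter> (\<Inter>p\<in>UNIV. ?C p) \<noteq> {}"
  proof (rule compact_imp_fip_image[OF compact_function_interval])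
    show "closed (?C p)" for p :: "'a \<times> nat"
      by (cases p) (auto intro!: closed_Collect_all closed_Collect_le continuous_intros)
  next
    fix S :: "('a \<times> nat) set"
    assume S: "finite S"
    obtain G where G: "\<And>x f. a x \<le> second_diff G x f" "\<And>x f. second_diff G x f \<le> b x"
      and inv: "\<And>y n x f. (y, n) \<in> S \<Longrightarrow>
        \<bar>second_diff G x (f + y) - second_diff G x f\<bar> \<le> b x / Suc n"
      using almost_invariant_second_diff[OF S, of a F b] assms by blast
    have "(\<lambda>x. second_diff G x 0) \<in> ?C (y, n)" if "(y, n) \<in> S" for y n
    proof -
      have "\<bar>second_diff G (x + y) 0 + second_diff G (x - y) 0 -
          (2 * second_diff G x 0 + 2 * second_diff G y 0)\<bar> \<le> 2 * (b x / Suc n)" for x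
        \<comment> \<open>The increment between \<open>- y\<close> and 0 is again one along
          \<open>y\<close>, now starting at \<open>- y\<close>.\<close>
        unfolding second_diff_parallelogram
        using inv[OF that, of x 0] inv[OF that, of x "- y"] by simp
      then show ?thesis by simp
    qed
    then show "?K \<inter> (\<Inter>p\<in>S. ?C p) \<noteq> {}"
      using G by (intro ex_in_conv[THEN iffD1] exI[of _ "\<lambda>x. second_diff G x 0"]) fast
  qed
  then obtain Q where Q: "\<And>x. a x \<le> Q x" "\<And>x. Q x \<le> b x"
    and approx: "\<And>x y n. \<bar>Q (x + y) + Q (x - y) - (2 * Q x + 2 * Q y)\<bar> \<le> 2 * (b x / Suc n)"
    by auto
  have "Q (x + y) + Q (x - y) = 2 * Q x + 2 * Q y" for x y
  proof -
    have "(\<lambda>n. 2 * (b x / Suc n)) \<longlonglongrightarrow> 2 * 0"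
      by (intro tendsto_mult tendsto_const LIMSEQ_Suc[OF lim_const_over_n])
    then have "\<bar>Q (x + y) + Q (x - y) - (2 * Q x + 2 * Q y)\<bar> \<le> 2 * 0"
      by (rule LIMSEQ_le_const) (use approx in blast)
    then show ?thesis by simp
  qed
  with Q show ?thesis by blast
qed

section \<open>The theorem of Jordan and von Neumann\<close>

text \<open>Subtracting \<open>t * h 1\<close> leaves an additive function that vanishes on the
  integers, so it is 1-periodic and bounded everywhere. A bounded additive function is zero, as
  \<open>d (n * t) = n * d t\<close>.\<close>

lemma additive_bounded_imp_linear:
  fixes h :: "real \<Rightarrow> real"
  assumes add: "\<And>s t. h (s + t) = h s + h t" and bound: "\<And>t. \<bar>t\<bar> \<le> 1 \<Longrightarrow> \<bar>h t\<bar> \<le> K"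
  shows "h t = t * h 1"
proof -
  define d where "d t = h t - t * h 1" for t
  interpret d: additive d by standard (simp add: d_def add algebra_simps)
  have mult: "d (of_nat n * t) = of_nat n * d t" for n t
    by (induction n) (simp_all add: d.zero d.add algebra_simps)
  have "d 1 = 0" by (simp add: d_def)
  then have nat0: "d (of_nat n) = 0" for n
    using mult[of n 1] by simp
  have int0: "d (of_int i) = 0" for i
    by (cases i rule: int_cases2) (use nat0 d.minus in \<open>simp_all\<close>)
  have d_bound: "\<bar>d t\<bar> \<le> 2 * K" for t
  proof -
    have "d t = d (frac t)"
      using d.diff[of t "of_int \<lfloor>t\<rfloor>"] by (simp add: frac_def int0)
    moreover have "\<bar>d (frac t)\<bar> \<le> \<bar>h (frac t)\<bar> + \<bar>frac t\<bar> * \<bar>h 1\<bar>"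
      unfolding d_def abs_mult[symmetric] by linarith
    moreover have "\<bar>frac t\<bar> \<le> 1"
      using frac_ge_0[of t] frac_lt_1[of t] by linarith
    moreover from this have "\<bar>frac t\<bar> * \<bar>h 1\<bar> \<le> \<bar>h 1\<bar>"
      by (simp add: mult_left_le_one_le)
    ultimately show ?thesis
      using bound[of "frac t"] bound[of 1] by simp
  qed
  have "d t = 0"
  proof (rule ccontr)
    assume "d t \<noteq> 0"
    then obtain n where "2 * K < of_nat n * \<bar>d t\<bar>"
      using reals_Archimedean3[of "\<bar>d t\<bar>"] by (meson zero_less_abs_iff)
    then show False
      using d_bound[of "of_nat n * t"] by (simp add: mult abs_mult)
  qed
  then show ?thesis by (simp add: d_def)
qed

locale equivalent_inner_product =
  fixes ip :: "'a::real_normed_vector \<Rightarrow> 'a \<Rightarrow> real" and a b :: real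
  assumes commute: "ip x y = ip y x"
    and add_left: "ip (x + y) z = ip x z + ip y z"
    and scale_left: "ip (c *\<^sub>R x) y = c * ip x y"
    and lower: "a * (norm x)\<^sup>2 \<le> ip x x"
    and upper: "ip x x \<le> b * (norm x)\<^sup>2"
    and a_pos: "0 < a"

text \<open>The inner product is the polarization of \<open>Q\<close>. Additivity comes from the
  parallelogram law alone, homogeneity from additivity and the bounds on \<open>Q\<close>.\<close>

lemma jordan_von_neumann:
  fixes Q :: "'a::real_normed_vector \<Rightarrow> real"
  assumes par: "\<And>x y. Q (x + y) + Q (x - y) = 2 * Q x + 2 * Q y"
    and bounds: "\<And>x. a * (norm x)\<^sup>2 \<le> Q x" "\<And>x. Q x \<le> b * (norm x)\<^sup>2" and a: "0 < a"
  shows "equivalent_inner_product (\<lambda>x y. (Q (x + y) - Q (x - y)) / 4) a b"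
proof -
  define ip where "ip x y = (Q (x + y) - Q (x - y)) / 4" for x y
  have Q0: "Q 0 = 0" using par[of 0 0] by simp
  have even: "Q (- x) = Q x" for x using par[of 0 x] Q0 by simp
  have even': "Q (x - y) = Q (y - x)" for x y using even[of "x - y"] by simp
  have commute: "ip x y = ip y x" for x y
    unfolding ip_def using even'[of x y] by (simp add: add.commute)
  have add: "ip (x + y) z = ip x z + ip y z" for x y z
  proof -
    have "Q (y + z - x) = Q (x - z - y)" "Q (y - z - x) = Q (x + z - y)"
      using even'[of "y + z" x] even'[of "y - z" x] by (simp_all add: algebra_simps)
    moreover have "x + z + y = x + y + z" "x - z + y = x + y - z" "y + z + x = x + y + z"
      "y - z + x = x + y - z"
      by simp_all
    \<comment> \<open>Subtract the second instance from the first and the fourth from the third,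
      then add: the terms mixing \<open>x\<close> and \<open>y\<close> with opposite signs cancel
      because \<open>Q\<close> is even.\<close>
    ultimately show ?thesis
      using par[of "x + z" y] par[of "x - z" y] par[of "y + z" x] par[of "y - z" x]
      unfolding ip_def by (simp add: field_simps)
  qed
  have self: "ip x x = Q x" for x
    using par[of x x] Q0 by (simp add: ip_def)
  have scale: "ip (c *\<^sub>R x) y = c * ip x y" for c x y
  proof -
    have "\<bar>ip (t *\<^sub>R x) y\<bar> \<le> b * (norm x + norm y)\<^sup>2" if t: "\<bar>t\<bar> \<le> 1" for t
    proof (cases "b < 0")
      case True
      \<comment> \<open>With \<open>b < 0 < a\<close> the two bounds on \<open>Q\<close> contradict
        each other at any nonzero vector, so the space is trivial.\<close>
      have "norm v = 0" for v :: 'a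
      proof (rule ccontr)
        assume "norm v \<noteq> 0"
        then have "b * (norm v)\<^sup>2 < 0" "0 < a * (norm v)\<^sup>2"
          using True a by (simp_all add: mult_neg_pos)
        then show False using bounds[of v] by linarith
      qed
      then have "v = 0" for v :: 'a by simp
      then have "t *\<^sub>R x = 0" "x = 0" "y = 0" by blast+
      then show ?thesis by (simp add: ip_def)
    next
      case False
      have nonneg: "0 \<le> Q v" for v
        by (rule order_trans[OF _ bounds(1)]) (use a in simp)
      have *: "Q v \<le> b * (norm x + norm y)\<^sup>2" if "norm v \<le> norm x + norm y" for v
        using bounds(2)[of v] mult_left_mono[OF power_mono[OF that norm_ge_zero, of 2], of b] False
        by linarith
      have tx: "norm (t *\<^sub>R x) \<le> norm x"
        using t by (simp add: mult_left_le_one_le)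
      have "Q (t *\<^sub>R x + y) \<le> b * (norm x + norm y)\<^sup>2" "Q (t *\<^sub>R x - y) \<le> b * (norm x + norm y)\<^sup>2"
        using tx norm_triangle_ineq[of "t *\<^sub>R x" y] norm_triangle_ineq4[of "t *\<^sub>R x" y]
        by (intro *; linarith)+
      \<comment> \<open>Both values lie between 0 and the common bound, hence so does the absolute
        value of their difference.\<close>
      then have "\<bar>Q (t *\<^sub>R x + y) - Q (t *\<^sub>R x - y)\<bar> \<le> b * (norm x + norm y)\<^sup>2"
        using nonneg[of "t *\<^sub>R x + y"] nonneg[of "t *\<^sub>R x - y"] by (simp add: abs_le_iff)
      then show ?thesis
        unfolding ip_def abs_divide
        using abs_ge_zero[of "Q (t *\<^sub>R x + y) - Q (t *\<^sub>R x - y)"] by simp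
    qed
    then show ?thesis
      using additive_bounded_imp_linear[of "\<lambda>t. ip (t *\<^sub>R x) y" "b * (norm x + norm y)\<^sup>2" c]
      by (simp add: scaleR_left_distrib add)
  qed
  have "equivalent_inner_product ip a b"
    by standard (use commute add scale bounds self a in \<open>simp_all\<close>)
  then show ?thesis by (simp add: ip_def[abs_def])
qed

section \<open>The Hilbert space of an equivalent inner product\<close>

context equivalent_inner_product
begin

lemma add_right: "ip z (x + y) = ip z x + ip z y"
  by (metis commute add_left)

lemma scale_right: "ip y (c *\<^sub>R x) = c * ip y x"
  by (metis commute scale_left)

lemma diff_left: "ip (x - y) z = ip x z - ip y z"
  by (metis add_left add_diff_cancel diff_add_cancel)

lemma diff_right: "ip z (x - y) = ip z x - ip z y"
  by (metis commute diff_left)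

lemma nonneg: "0 \<le> ip x x"
  by (rule order_trans[OF _ lower]) (use a_pos in simp)

lemma pos: "x \<noteq> 0 \<Longrightarrow> 0 < ip x x"
  by (rule less_le_trans[OF _ lower]) (use a_pos in simp)

lemma zero_left: "ip 0 y = 0"
  using scale_left[of 0 0 y] by simp

lemma cauchy_schwarz: "(ip x y)\<^sup>2 \<le> ip x x * ip y y"
proof (cases "y = 0")
  case True
  then show ?thesis by (simp add: zero_left commute[of x 0])
next
  case False
  \<comment> \<open>The component of \<open>x\<close> orthogonal to \<open>y\<close>, multiplied by
    \<open>ip y y\<close> to avoid a division.\<close>
  have "0 \<le> ip (ip y y *\<^sub>R x - ip x y *\<^sub>R y) (ip y y *\<^sub>R x - ip x y *\<^sub>R y)"
    by (rule nonneg)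
  also have "\<dots> = ip y y * (ip x x * ip y y - (ip x y)\<^sup>2)"
    by (simp add: diff_left diff_right scale_left scale_right commute[of y x] power2_eq_square
        algebra_simps)
  finally show ?thesis
    using pos[OF False] by (simp add: zero_le_mult_iff)
qed

lemma triangle: "sqrt (ip (x + y) (x + y)) \<le> sqrt (ip x x) + sqrt (ip y y)"
proof (rule real_le_lsqrt)
  have "ip x y \<le> sqrt (ip x x) * sqrt (ip y y)"
    using real_le_rsqrt[OF cauchy_schwarz[of x y]] by (simp add: real_sqrt_mult)
  then show "ip (x + y) (x + y) \<le> (sqrt (ip x x) + sqrt (ip y y))\<^sup>2"
    by (simp add: power2_sum nonneg add_left add_right commute[of y x])
qed (use nonneg in simp_all)

section \<open>The metric of the inner product and its equivalence with the norm\<close>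

definition ip_dist :: "'a \<Rightarrow> 'a \<Rightarrow> real" where
  "ip_dist x y = sqrt (ip (x - y) (x - y))"

lemma ip_dist_lower: "sqrt a * dist x y \<le> ip_dist x y"
  unfolding ip_dist_def dist_norm
  by (rule real_le_rsqrt) (use lower[of "x - y"] a_pos in \<open>simp add: power_mult_distrib\<close>)

text \<open>The absolute value covers the trivial space, where \<open>b\<close> may be
  negative.\<close>

lemma ip_dist_upper: "ip_dist x y \<le> sqrt \<bar>b\<bar> * dist x y"
  unfolding ip_dist_def dist_norm
proof (rule real_le_lsqrt)
  have "ip (x - y) (x - y) \<le> b * (norm (x - y))\<^sup>2" by (rule upper)
  also have "\<dots> \<le> \<bar>b\<bar> * (norm (x - y))\<^sup>2" by (simp add: mult_right_mono)
  finally show "ip (x - y) (x - y) \<le> (sqrt \<bar>b\<bar> * norm (x - y))\<^sup>2"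
    by (simp add: power_mult_distrib)
qed (simp_all add: nonneg)

lemma Metric_space_ip_dist: "Metric_space UNIV ip_dist"
proof
  show "0 \<le> ip_dist x y" for x y
    by (simp add: ip_dist_def nonneg)
  show "ip_dist x y = ip_dist y x" for x y
    unfolding ip_dist_def by (simp add: diff_left diff_right algebra_simps)
  show "ip_dist x y = 0 \<longleftrightarrow> x = y" for x y
    using pos[of "x - y"] by (cases "x = y") (auto simp: ip_dist_def zero_left)
  show "ip_dist x z \<le> ip_dist x y + ip_dist y z" for x y z
    unfolding ip_dist_def using triangle[of "x - y" "y - z"] by simp
qed

sublocale ip: Metric_space UNIV ip_dist
  by (rule Metric_space_ip_dist)

lemma ip_dist_less_imp_dist_less: "ip_dist x y < sqrt a * e \<Longrightarrow> dist x y < e"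
  using le_less_trans[OF ip_dist_lower] a_pos by (fastforce simp: mult_less_cancel_left)

text \<open>The summand 1 keeps the divisor positive even when \<open>b\<close> is 0.\<close>

lemma dist_less_imp_ip_dist_less:
  assumes "dist x y < e / (sqrt \<bar>b\<bar> + 1)"
  shows "ip_dist x y < e"
proof -
  have "ip_dist x y \<le> (sqrt \<bar>b\<bar> + 1) * dist x y"
    using ip_dist_upper[of x y] zero_le_dist[of x y] unfolding distrib_right by linarith
  also have "\<dots> < e"
    using assms by (simp add: pos_less_divide_eq add_nonneg_pos mult.commute)
  finally show ?thesis .
qed

lemma mtopology_ip_dist: "ip.mtopology = euclidean"
proof -
  have "openin ip.mtopology U \<longleftrightarrow> open U" for U
  proof
    assume U: "openin ip.mtopology U"
    show "open U"
      unfolding open_dist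
    proof
      fix x assume "x \<in> U"
      then obtain r where r: "r > 0" "ip.mball x r \<subseteq> U"
        using U by (auto simp: ip.openin_mtopology)
      then show "\<exists>e>0. \<forall>y. dist y x < e \<longrightarrow> y \<in> U"
        using dist_less_imp_ip_dist_less[of x _ r]
        by (intro exI[of _ "r / (sqrt \<bar>b\<bar> + 1)"])
          (auto simp: subset_iff dist_commute intro!: divide_pos_pos add_nonneg_pos)
    qed
  next
    assume U: "open U"
    show "openin ip.mtopology U"
      unfolding ip.openin_mtopology
    proof (intro conjI allI impI)
      fix x assume "x \<in> U"
      then obtain e where e: "e > 0" "\<forall>y. dist y x < e \<longrightarrow> y \<in> U"
        using U by (auto simp: open_dist)
      then show "\<exists>r>0. ip.mball x r \<subseteq> U"
        using ip_dist_less_imp_dist_less[of x _ e] a_pos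
        by (intro exI[of _ "sqrt a * e"]) (auto simp: dist_commute)
    qed simp
  qed
  then show ?thesis by (simp add: topology_eq)
qed

text \<open>The lower bound turns Cauchy sequences for \<open>ip_dist\<close> into Cauchy sequences
  for the norm, and limits agree because the topologies do.\<close>

lemma mcomplete_ip_dist:
  assumes "complete (UNIV :: 'a set)"
  shows "ip.mcomplete"
  unfolding ip.mcomplete_def mtopology_ip_dist
proof (intro allI impI)
  fix \<sigma> :: "nat \<Rightarrow> 'a"
  assume \<sigma>: "ip.MCauchy \<sigma>"
  have "Cauchy \<sigma>"
    unfolding Cauchy_def
  proof (intro allI impI)
    fix e :: real assume "e > 0"
    then have "sqrt a * e > 0" using a_pos by simp
    then obtain N where "\<forall>n n'. N \<le> n \<longrightarrow> N \<le> n' \<longrightarrow> ip_dist (\<sigma> n) (\<sigma> n') < sqrt a * e"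
      using \<sigma> unfolding ip.MCauchy_def by blast
    then show "\<exists>M. \<forall>m\<ge>M. \<forall>n\<ge>M. dist (\<sigma> m) (\<sigma> n) < e"
      using ip_dist_less_imp_dist_less by blast
  qed
  then show "\<exists>x. limitin euclidean \<sigma> x sequentially"
    using assms by (auto simp: complete_def)
qed

lemma inner_dist_UNIV:
  assumes "carrier H = UNIV" "\<And>x y. x \<ominus>\<^bsub>H\<^esub> y = x - y"
  shows "inner_dist H ip = ip_dist"
  using assms by (simp add: fun_eq_iff inner_dist_def ip_dist_def)

end

section \<open>The Banach space as a carrier-based vector space\<close>

definition type_module :: "(real, 'a::real_vector) module" where
  "type_module = \<lparr>carrier = UNIV, mult = (\<lambda>x y. 0), one = 0, zero = 0, add = (+), smult = (*\<^sub>R)\<rparr>"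

lemma type_module_simps [simp]:
  "carrier type_module = UNIV" "\<zero>\<^bsub>type_module\<^esub> = 0" "x \<oplus>\<^bsub>type_module\<^esub> y = x + y"
  "c \<odot>\<^bsub>type_module\<^esub> x = c *\<^sub>R x"
  by (simp_all add: type_module_def)

lemma abelian_group_type_module: "abelian_group type_module"
  by (rule abelian_groupI) (auto simp: algebra_simps intro: exI[of _ "- x" for x])

lemma minus_type_module [simp]: "x \<ominus>\<^bsub>type_module\<^esub> y = x - y"
proof -
  interpret abelian_group type_module by (rule abelian_group_type_module)
  have "\<ominus>\<^bsub>type_module\<^esub> y = - y"
    by (rule minus_equality) simp_all
  then show ?thesis by (simp add: a_minus_def)
qed

lemma cring_real_scalars: "cring real_scalars"
proof (rule cringI)
  show "abelian_group real_scalars"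
    by (rule abelian_groupI) (auto simp: real_scalars_def intro: exI[of _ "- x" for x])
  show "comm_monoid real_scalars"
    by (rule comm_monoidI) (auto simp: real_scalars_def)
qed (auto simp: real_scalars_def algebra_simps)

lemma module_type_module: "Module.module real_scalars type_module"
  by (rule moduleI[OF cring_real_scalars abelian_group_type_module])
    (auto simp: real_scalars_def scaleR_left_distrib scaleR_right_distrib)

text \<open>The Hilbert space is the same vector space under the new inner product; the identity is
  a homeomorphism since the two topologies coincide.\<close>

lemma isomorphic_if_equivalent_inner_product:
  fixes ip :: "'a::banach \<Rightarrow> 'a \<Rightarrow> real"
  assumes "equivalent_inner_product ip a b"
  shows "isomorphic_to_hilbert_space TYPE('a)"
proof -
  interpret equivalent_inner_product ip a b by fact
  have "real_hilbert_space type_module ip"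
  proof (intro real_hilbert_space.intro module_type_module real_hilbert_space_axioms.intro)
    show "ip x y = ip y x" for x y by (rule commute)
    show "Metric_space.mcomplete (carrier type_module) (inner_dist type_module ip)"
      using mcomplete_ip_dist complete_UNIV by (simp add: inner_dist_UNIV)
  qed (simp_all add: add_left scale_left pos)
  moreover have "linear_homeomorphism id type_module ip"
    by (simp add: linear_homeomorphism_def inner_dist_UNIV mtopology_ip_dist)
  ultimately show ?thesis
    unfolding isomorphic_to_hilbert_space_def by blast
qed

theorem lemma19:
  assumes "\<exists>(F :: 'a::banach \<Rightarrow> real) \<mu> \<gamma>. \<mu> > 0 \<and> strongly_convex \<mu> F \<and> smooth \<gamma> F"
  shows "isomorphic_to_hilbert_space TYPE('a)"
proof -
  obtain F :: "'a \<Rightarrow> real" and \<mu> \<gamma> where F: "\<mu> > 0" "strongly_convex \<mu> F" "smooth \<gamma> F"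
    using assms by blast
  \<comment> \<open>Strong convexity supplies the lower bound, nonnegative because \<mu> is
    positive, and smoothness the upper one.\<close>
  then have "\<exists>Q :: 'a \<Rightarrow> real. (\<forall>x. \<mu> * (norm x)\<^sup>2 \<le> Q x \<and> Q x \<le> \<gamma> * (norm x)\<^sup>2) \<and>
      (\<forall>x y. Q (x + y) + Q (x - y) = 2 * Q x + 2 * Q y)"
    using exists_parallelogram[of "\<lambda>x. \<mu> * (norm x)\<^sup>2" F "\<lambda>x. \<gamma> * (norm x)\<^sup>2"]
      strongly_convex_second_diff[of \<mu> F] smooth_second_diff[of \<gamma> F] by simp
  then obtain Q :: "'a \<Rightarrow> real"
    where "\<And>x. \<mu> * (norm x)\<^sup>2 \<le> Q x" "\<And>x. Q x \<le> \<gamma> * (norm x)\<^sup>2"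
      "\<And>x y. Q (x + y) + Q (x - y) = 2 * Q x + 2 * Q y"
    by blast
  then show ?thesis
    using F(1) by (intro isomorphic_if_equivalent_inner_product[OF jordan_von_neumann[of Q \<mu> \<gamma>]])
qed

end
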